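(* Let $\alpha\in(0,1)$ be irrational with negative continued fraction data $(a_i)$, $(D_i)$ as in the context, and let $(b_i)_{i\ge1}$ be a sequence of nonnegative integers such that the series $\beta=\sum_{k=1}^\infty b_kD_k$ converges. Then [$0\le\beta<1$ and $(b_i)$ is the sequence of Davenport coefficients of $\beta$] if and only if $b_i<a_i$ for all $i\ge1$ and $(b_i)$ contains no consecutive block of the form $a_i-1,a_{i+1}-2,a_{i+2}-2,\dots,a_{j-1}-2,a_j-1$ (for some $i<j$) and no infinite tail of the form $a_i-1,a_{i+1}-2,a_{i+2}-2,a_{i+3}-2,\dots$.
   Context: Negative continued fraction of an irrational $\alpha\in(0,1)$: put $\alpha_1=\alpha$ and recursively $a_i=\lceil 1/\alpha_i\rceil$, $\alpha_{i+1}=a_i-1/\alpha_i$; then $a_i\ge2$, $0<\alpha_{i+1}<1$. Put $D_0=1$ and $D_i=\alpha_1\alpha_2\cdots\alpha_i$ for $i\ge1$. Davenport expansion of $\beta\in[0,1)$: put $\beta_1=\beta$ and recursively $b_i=\lfloor \beta_i/\alpha_i\rfloor$, $\beta_{i+1}=\beta_i/\alpha_i-b_i$; the integers $b_i$ (which satisfy $0\le b_i\le a_i-1$) are the Davenport coefficients of $\beta$, and $\beta=\sum_{k\ge1}b_kD_k$. *)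

theory Defs
  imports Complex_Main
begin

(* All sequences are indexed from 1, following the usual notation; the value of each
   recursive sequence at index 0 is a dummy. *)

fun ncf_rem :: "real \<Rightarrow> nat \<Rightarrow> real" where
  "ncf_rem \<alpha> 0 = \<alpha>"
| "ncf_rem \<alpha> (Suc 0) = \<alpha>"
| "ncf_rem \<alpha> (Suc (Suc i)) =
     real_of_int \<lceil>1 / ncf_rem \<alpha> (Suc i)\<rceil> - 1 / ncf_rem \<alpha> (Suc i)"

definition ncf_coeff :: "real \<Rightarrow> nat \<Rightarrow> int" where
  "ncf_coeff \<alpha> i = \<lceil>1 / ncf_rem \<alpha> i\<rceil>"

definition ncf_D :: "real \<Rightarrow> nat \<Rightarrow> real" where
  "ncf_D \<alpha> i = (\<Prod>k = 1..i. ncf_rem \<alpha> k)"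

fun davenport_rem :: "real \<Rightarrow> real \<Rightarrow> nat \<Rightarrow> real" where
  "davenport_rem \<alpha> \<beta> 0 = \<beta>"
| "davenport_rem \<alpha> \<beta> (Suc 0) = \<beta>"
| "davenport_rem \<alpha> \<beta> (Suc (Suc i)) =
     davenport_rem \<alpha> \<beta> (Suc i) / ncf_rem \<alpha> (Suc i)
       - real_of_int \<lfloor>davenport_rem \<alpha> \<beta> (Suc i) / ncf_rem \<alpha> (Suc i)\<rfloor>"

definition davenport_coeff :: "real \<Rightarrow> real \<Rightarrow> nat \<Rightarrow> int" where
  "davenport_coeff \<alpha> \<beta> i = \<lfloor>davenport_rem \<alpha> \<beta> i / ncf_rem \<alpha> i\<rfloor>"

end

theory Submission
  imports Defs
begin

text \<open>
  Let \<open>T i\<close> be the tail sum of \<open>b k * D k\<close> over \<open>k \<ge> i\<close>. The Davenport remainder of index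
  \<open>i + 1\<close> has to be \<open>T (i + 1) / D i\<close>, so \<open>b\<close> is the Davenport sequence iff \<open>T (i + 1) < D i\<close>
  for all \<open>i\<close>. The rest uses only \<open>a i * D i = D (i - 1) + D (i + 1)\<close> with \<open>D\<close> positive and
  decreasing. By this recurrence, \<open>T (i + 1) \<ge> D i - D (i + 1)\<close> propagates backwards through a digit
  \<open>a i - 2\<close>, is started by a digit \<open>a i - 1\<close>, and turns into \<open>T i \<ge> D (i - 1)\<close> at a digit
  \<open>a i - 1\<close>. Conversely, without forbidden blocks the weak inequality \<open>T (i + 1) \<le> D i\<close> holds by
  backward induction on partial sums, and equality would force an infinite forbidden tail.
\<close>

section \<open>Digit expansions over a sequence with a three-term recurrence\<close>

locale digit_expansion =
  fixes D :: "nat \<Rightarrow> real" and a :: "nat \<Rightarrow> int" and b :: "nat \<Rightarrow> nat"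
  assumes D_pos: "0 < D n"
    and D_decreasing: "D (Suc n) < D n"
    and D_rec: "of_int (a (Suc n)) * D (Suc n) = D n + D (Suc (Suc n))"
    and summable_digits: "summable (\<lambda>k. real (b k) * D k)"
begin

definition tail :: "nat \<Rightarrow> real" where
  "tail i = (\<Sum>k. real (b (k + i)) * D (k + i))"

definition forbidden_block :: "nat \<Rightarrow> nat \<Rightarrow> bool" where
  "forbidden_block i j \<longleftrightarrow> 1 \<le> i \<and> i < j \<and> int (b i) = a i - 1 \<and>
     (\<forall>k. i < k \<and> k < j \<longrightarrow> int (b k) = a k - 2) \<and> int (b j) = a j - 1"

definition forbidden_tail :: "nat \<Rightarrow> bool" where
  "forbidden_tail i \<longleftrightarrow> int (b i) = a i - 1 \<and> (\<forall>k>i. int (b k) = a k - 2)"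

text \<open>What remains of a forbidden block after its opening digit; \<open>j = i\<close> is
  allowed, so a lone digit \<open>a i - 1\<close> counts.\<close>

definition block_suffix :: "nat \<Rightarrow> bool" where
  "block_suffix i \<longleftrightarrow>
     (\<exists>j\<ge>i. (\<forall>k. i \<le> k \<and> k < j \<longrightarrow> int (b k) = a k - 2) \<and> int (b j) = a j - 1)"

lemma summable_shift: "summable (\<lambda>k. real (b (k + i)) * D (k + i))"
  using summable_ignore_initial_segment[OF summable_digits] .

lemma tail_nonneg: "0 \<le> tail i"
  unfolding tail_def using D_pos
  by (intro suminf_nonneg[OF summable_shift]) (simp add: less_imp_le)

lemma tail_Suc: "tail i = real (b i) * D i + tail (Suc i)"
  using suminf_split_head[OF summable_shift[of i]] by (simp add: tail_def)

lemma digit_scaled: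
  assumes "int (b i) = a i - c"
  shows "real (b i) * D i = of_int (a i) * D i - of_int c * D i"
proof -
  have "real (b i) = of_int (a i - c)"
    using assms by (metis of_int_of_nat_eq)
  then show ?thesis by (simp add: left_diff_distrib)
qed

lemma digit_scaled_le:
  assumes "int (b i) \<le> a i - c"
  shows "real (b i) * D i \<le> of_int (a i) * D i - of_int c * D i"
proof -
  have "real (b i) \<le> of_int (a i - c)"
    using assms by (metis of_int_le_iff of_int_of_nat_eq)
  then have "real (b i) * D i \<le> of_int (a i - c) * D i"
    using D_pos[of i] by (intro mult_right_mono) auto
  then show ?thesis by (simp add: algebra_simps)
qed

text \<open>By \<open>D_rec\<close>, a digit \<open>a k - 2\<close> contributes
  \<open>(D (k-1) - D k) - (D k - D (k+1))\<close>, so the sum telescopes.\<close>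

lemma partial_sum_twos:
  assumes "\<And>k. k > i \<Longrightarrow> int (b k) = a k - 2"
  shows "(\<Sum>k<n. real (b (k + Suc i)) * D (k + Suc i))
           = D i - D (Suc i) - (D (n + i) - D (Suc (n + i)))"
proof (induction n)
  case (Suc n)
  have "int (b (n + Suc i)) = a (n + Suc i) - 2"
    by (rule assms) simp
  from digit_scaled[OF this] D_rec[of "n + i"] Suc show ?case by simp
qed simp

lemma tail_twos:
  assumes "\<And>k. k > i \<Longrightarrow> int (b k) = a k - 2"
  shows "tail (Suc i) = D i - D (Suc i)"
proof -
  \<comment> \<open>Only the consecutive differences of \<open>D\<close> have to vanish, so the
    value of the limit is irrelevant.\<close>
  have "decseq D"
    using D_decreasing by (simp add: decseq_SucI less_imp_le)
  then obtain L where L: "D \<longlonglongrightarrow> L"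
    using decseq_convergent[of D 0] D_pos less_imp_le by metis
  have "(\<lambda>n. D (n + i)) \<longlonglongrightarrow> L" "(\<lambda>n. D (n + Suc i)) \<longlonglongrightarrow> L"
    using L by (simp_all only: LIMSEQ_ignore_initial_segment)
  then have "(\<lambda>n. D i - D (Suc i) - (D (n + i) - D (Suc (n + i)))) \<longlonglongrightarrow> D i - D (Suc i) - (L - L)"
    by (intro tendsto_intros) simp_all
  then have "(\<lambda>k. real (b (k + Suc i)) * D (k + Suc i)) sums (D i - D (Suc i))"
    unfolding sums_def by (subst partial_sum_twos[OF assms]) simp_all
  then show ?thesis
    unfolding tail_def by (rule sums_unique[symmetric])
qed

section \<open>Forbidden patterns force large tails\<close>

lemma block_suffix_tail_ge:
  assumes "block_suffix (Suc i)"
  shows "D i - D (Suc i) \<le> tail (Suc i)"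
proof -
  obtain j where j: "Suc i \<le> j" "int (b j) = a j - 1"
    and two: "\<And>k. Suc i \<le> k \<Longrightarrow> k < j \<Longrightarrow> int (b k) = a k - 2"
    using assms unfolding block_suffix_def by blast
  \<comment> \<open>The closing digit alone contributes
    \<open>D m - D (m+1) + D (m+2)\<close>.\<close>
  have last: "D m - D (Suc m) \<le> tail (Suc m)" if "j = Suc m" for m
    using digit_scaled[OF j(2)] that tail_Suc[of j] tail_nonneg[of "Suc j"] D_rec[of m]
      D_pos[of "Suc (Suc m)"] by simp
  have "i \<le> j - 1" using j(1) by simp
  then show ?thesis
  proof (induction rule: inc_induct)
    case base
    show ?case using last[of "j - 1"] j(1) by simp
  next
    case (step m)
    have "int (b (Suc m)) = a (Suc m) - 2"
      using step.hyps by (intro two) simp_all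
    from digit_scaled[OF this] tail_Suc[of "Suc m"] D_rec[of m] step.IH
    show ?case by simp
  qed
qed

text \<open>The opening digit falls short of \<open>D i\<close> by \<open>D (i+1) - D (i+2)\<close>,
  and the block suffix behind it supplies at least that much.\<close>

lemma tail_ge_if_forbidden_block:
  assumes "forbidden_block (Suc i) j"
  shows "D i \<le> tail (Suc i)"
proof -
  have "block_suffix (Suc (Suc i))"
    using assms unfolding forbidden_block_def block_suffix_def
    by (metis Suc_le_eq)
  from block_suffix_tail_ge[OF this] tail_Suc[of "Suc i"] D_rec[of i] digit_scaled[of "Suc i" 1] assms
  show ?thesis by (simp add: forbidden_block_def)
qed

lemma tail_eq_if_forbidden_tail:
  assumes "forbidden_tail (Suc i)"
  shows "tail (Suc i) = D i"
  using assms tail_twos[of "Suc i"] tail_Suc[of "Suc i"] D_rec[of i] digit_scaled[of "Suc i" 1]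
  by (simp add: forbidden_tail_def)

lemma digit_less_if_tail_less:
  assumes "tail (Suc i) < D i"
  shows "int (b (Suc i)) < a (Suc i)"
proof -
  have "real (b (Suc i)) * D (Suc i) < of_int (a (Suc i)) * D (Suc i)"
    using assms tail_Suc[of "Suc i"] tail_nonneg[of "Suc (Suc i)"] D_rec[of i]
      D_pos[of "Suc (Suc i)"] by linarith
  then have "real (b (Suc i)) < of_int (a (Suc i))"
    using D_pos[of "Suc i"] by (simp add: mult_less_cancel_right_pos)
  then show ?thesis by linarith
qed

section \<open>Upper bounds for tails of admissible sequences\<close>

lemma block_suffix_two:
  assumes "int (b i) = a i - 2" and "block_suffix (Suc i)"
  shows "block_suffix i"
  using assms unfolding block_suffix_def
  by (metis Suc_leD Suc_le_eq le_neq_implies_less)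

text \<open>The sharper bound away from block suffixes is what makes the induction go through.\<close>

lemma partial_sum_bounds:
  assumes less: "\<And>i. i \<ge> 1 \<Longrightarrow> int (b i) < a i"
    and no_block: "\<And>i j. \<not> forbidden_block i j"
  shows "(\<Sum>k<n. real (b (k + Suc i)) * D (k + Suc i)) \<le> D i \<and>
    (\<not> block_suffix (Suc i) \<longrightarrow>
      (\<Sum>k<n. real (b (k + Suc i)) * D (k + Suc i)) \<le> D i - D (Suc i))"
proof (induction n arbitrary: i)
  case 0
  show ?case using D_pos[of i] D_decreasing[of i] by simp
next
  case (Suc n)
  define S where "S = (\<Sum>k<n. real (b (k + Suc (Suc i))) * D (k + Suc (Suc i)))"
  have S: "(\<Sum>k<Suc n. real (b (k + Suc i)) * D (k + Suc i)) = real (b (Suc i)) * D (Suc i) + S"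
    unfolding S_def by (subst sum.lessThan_Suc_shift) simp
  have IH: "S \<le> D (Suc i)"
    "\<not> block_suffix (Suc (Suc i)) \<Longrightarrow> S \<le> D (Suc i) - D (Suc (Suc i))"
    using Suc.IH[of "Suc i"] unfolding S_def by blast+
  note D_facts = D_rec[of i] D_decreasing[of "Suc i"] D_pos[of "Suc i"]
  consider "int (b (Suc i)) = a (Suc i) - 1" | "int (b (Suc i)) = a (Suc i) - 2"
    | "int (b (Suc i)) \<le> a (Suc i) - 3"
    using less[of "Suc i"] by fastforce
  then show ?case
  proof cases
    case 1
    \<comment> \<open>A suffix here would complete a forbidden block, so the sharper bound applies
      to \<open>S\<close>; as the digit is itself a block suffix, only the weak bound is
      owed.\<close>
    have "\<not> block_suffix (Suc (Suc i))"
      using no_block[of "Suc i"] 1 unfolding block_suffix_def forbidden_block_def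
      by (auto simp: Suc_le_eq)
    moreover have "block_suffix (Suc i)"
      using 1 unfolding block_suffix_def by (intro exI[of _ "Suc i"]) auto
    ultimately show ?thesis
      using IH(2) digit_scaled[OF 1] D_facts unfolding S by simp
  next
    case 2
    \<comment> \<open>If a suffix follows, it extends to \<open>Suc i\<close> and the weak bound
      suffices; otherwise the sharper bound is passed on.\<close>
    show ?thesis
      using IH digit_scaled[OF 2] D_facts block_suffix_two[OF 2] unfolding S
      by (cases "block_suffix (Suc (Suc i))") simp_all
  next
    case 3
    show ?thesis
      using IH(1) digit_scaled_le[OF 3] D_facts unfolding S by simp
  qed
qed

lemma tail_le:
  assumes "\<And>i. i \<ge> 1 \<Longrightarrow> int (b i) < a i" and "\<And>i j. \<not> forbidden_block i j"
  shows "tail (Suc i) \<le> D i"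
  unfolding tail_def using partial_sum_bounds[OF assms]
  by (intro suminf_le_const[OF summable_shift]) blast

text \<open>Division by \<open>D i\<close> gives \<open>b i - c = r - t / D i\<close>, which lies
  strictly between -1 and 1. As \<open>r\<close> is strictly inside the unit interval, the weak
  bound on \<open>t\<close> is enough.\<close>

lemma digit_if_scaled_eq:
  assumes "real (b i) * D i + t = (of_int c + r) * D i"
    and "0 \<le> t" and "t \<le> D i" and "0 < r" and "r < 1"
  shows "int (b i) = c"
proof -
  have "(real (b i) - of_int c - r) * D i \<le> 0 * D i" "(- 1) * D i \<le> (real (b i) - of_int c - r) * D i"
    using assms(1-3) by (simp_all add: algebra_simps)
  then have "real (b i) - of_int c - r \<le> 0" "- 1 \<le> real (b i) - of_int c - r"
    using D_pos[of i] by (simp_all only: mult_le_cancel_right_pos)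
  then have "real_of_int (int (b i)) < of_int (c + 1)" "real_of_int (c - 1) < of_int (int (b i))"
    using assms(4,5) by simp_all
  then show ?thesis
    unfolding of_int_less_iff by simp
qed

lemma tail_less:
  assumes less: "\<And>i. i \<ge> 1 \<Longrightarrow> int (b i) < a i" and no_block: "\<And>i j. \<not> forbidden_block i j"
    and no_tail: "\<not> forbidden_tail (Suc i)"
  shows "tail (Suc i) < D i"
proof (rule ccontr)
  assume "\<not> tail (Suc i) < D i"
  then have eq: "tail (Suc i) = D i"
    using tail_le[OF less no_block, of i] by simp
  \<comment> \<open>The recurrence turns the assumed tail into \<open>a (m+1) - c + ?r\<close> times
    \<open>D (m+1)\<close>. The value \<open>c = 1\<close> is the case of equality,
    \<open>c = 2\<close> the state after it.\<close>
  have digit: "int (b (Suc m)) = a (Suc m) - c"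
    if "tail (Suc m) = D m - (of_int c - 1) * D (Suc m)" for m c
  proof (rule digit_if_scaled_eq)
    let ?r = "1 - D (Suc (Suc m)) / D (Suc m)"
    show "real (b (Suc m)) * D (Suc m) + tail (Suc (Suc m)) = (of_int (a (Suc m) - c) + ?r) * D (Suc m)"
      using that tail_Suc[of "Suc m"] D_rec[of m] D_pos[of "Suc m", THEN less_imp_neq]
      by (simp add: distrib_right left_diff_distrib)
    show "0 < ?r" "?r < 1"
      using D_pos D_decreasing by (simp_all add: field_simps)
  qed (use tail_nonneg tail_le[OF less no_block] in auto)
  have first: "int (b (Suc i)) = a (Suc i) - 1"
    using digit[of i 1] eq by simp
  have two_step: "int (b (Suc m)) = a (Suc m) - 2 \<and> tail (Suc (Suc m)) = D (Suc m) - D (Suc (Suc m))"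
    if "tail (Suc m) = D m - D (Suc m)" for m
  proof
    show two: "int (b (Suc m)) = a (Suc m) - 2"
      using digit[of m 2] that by simp
    show "tail (Suc (Suc m)) = D (Suc m) - D (Suc (Suc m))"
      using digit_scaled[OF two] that tail_Suc[of "Suc m"] D_rec[of m] by simp
  qed
  \<comment> \<open>After the first digit this state reproduces itself, emitting
    \<open>a k - 2\<close> forever.\<close>
  have "tail (Suc m) = D m - D (Suc m)" if "Suc i \<le> m" for m
    using that
  proof (induction rule: dec_induct)
    case base
    show ?case
      using digit_scaled[OF first] eq tail_Suc[of "Suc i"] D_rec[of i] by simp
  next
    case (step m)
    then show ?case using two_step by blast
  qed
  then have "int (b k) = a k - 2" if "k > Suc i" for k
    using two_step[of "k - 1"] that by (cases k) auto
  with first no_tail show False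
    unfolding forbidden_tail_def by blast
qed

lemma tail_less_iff:
  "(\<forall>i. tail (Suc i) < D i) \<longleftrightarrow>
    (\<forall>i\<ge>1. int (b i) < a i) \<and> \<not> (\<exists>i j. forbidden_block i j) \<and> \<not> (\<exists>i\<ge>1. forbidden_tail i)"
    (is "?L \<longleftrightarrow> ?less \<and> ?no_block \<and> ?no_tail")
proof
  assume L: ?L
  have ?less
    using L digit_less_if_tail_less by (metis One_nat_def Suc_le_D)
  moreover have ?no_block
  proof
    assume "\<exists>i j. forbidden_block i j"
    then obtain i j where "forbidden_block (Suc i) j"
      unfolding forbidden_block_def by (metis One_nat_def Suc_le_D)
    then show False
      using L tail_ge_if_forbidden_block by (meson leD)
  qed
  moreover have ?no_tail
    using L tail_eq_if_forbidden_tail by (metis One_nat_def Suc_le_D less_irrefl)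
  ultimately show "?less \<and> ?no_block \<and> ?no_tail" by blast
next
  assume "?less \<and> ?no_block \<and> ?no_tail"
  then show ?L by (auto intro!: tail_less)
qed

end

section \<open>Negative continued fractions and the Davenport algorithm\<close>

lemma irrational_not_of_int: "x \<notin> \<rat> \<Longrightarrow> x \<noteq> of_int n"
  by auto

lemma inverse_irrational:
  fixes x :: real
  assumes "x \<notin> \<rat>"
  shows "1 / x \<notin> \<rat>"
proof
  assume "1 / x \<in> \<rat>"
  then have "inverse (1 / x) \<in> \<rat>" by (rule Rats_inverse)
  with assms show False by simp
qed

text \<open>Irrationality is carried through the induction because it keeps the reciprocal off the
  integers, which makes the next remainder strictly positive.\<close>

lemma ncf_rem_bounds:
  assumes "0 < \<alpha>" "\<alpha> < 1" "\<alpha> \<notin> \<rat>"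
  shows "0 < ncf_rem \<alpha> i \<and> ncf_rem \<alpha> i < 1 \<and> ncf_rem \<alpha> i \<notin> \<rat>"
  using assms
proof (induction \<alpha> i rule: ncf_rem.induct)
  case (3 \<alpha> i)
  let ?y = "1 / ncf_rem \<alpha> (Suc i)"
  have y: "?y \<notin> \<rat>"
    using 3 inverse_irrational by blast
  have "?y < of_int \<lceil>?y\<rceil>"
    using le_of_int_ceiling[of ?y] irrational_not_of_int[OF y] less_le by blast
  moreover have "of_int \<lceil>?y\<rceil> - ?y < 1"
    using ceiling_correct[of ?y] by linarith
  moreover have "of_int \<lceil>?y\<rceil> - ?y \<notin> \<rat>"
  proof
    assume "of_int \<lceil>?y\<rceil> - ?y \<in> \<rat>"
    from Rats_diff[OF Rats_of_int[of "\<lceil>?y\<rceil>"] this] y show False by simp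
  qed
  ultimately show ?case by simp
qed auto

lemma ncf_D_0: "ncf_D \<alpha> 0 = 1"
  by (simp add: ncf_D_def)

lemma ncf_D_Suc: "ncf_D \<alpha> (Suc i) = ncf_D \<alpha> i * ncf_rem \<alpha> (Suc i)"
  by (simp add: ncf_D_def)

lemma digit_expansion_ncf:
  assumes "0 < \<alpha>" "\<alpha> < 1" "\<alpha> \<notin> \<rat>"
    and "summable (\<lambda>k. real (b k) * ncf_D \<alpha> k)"
  shows "digit_expansion (ncf_D \<alpha>) (ncf_coeff \<alpha>) b"
proof
  note bounds = ncf_rem_bounds[OF assms(1-3)]
  show pos: "0 < ncf_D \<alpha> n" for n
    using bounds by (simp add: ncf_D_def prod_pos)
  show "ncf_D \<alpha> (Suc n) < ncf_D \<alpha> n" for n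
    using pos[of n] bounds[of "Suc n"] by (simp add: ncf_D_Suc)
  \<comment> \<open>This is the recursion for the remainders multiplied by
    \<open>ncf_D \<alpha> (Suc n)\<close>.\<close>
  show "of_int (ncf_coeff \<alpha> (Suc n)) * ncf_D \<alpha> (Suc n) = ncf_D \<alpha> n + ncf_D \<alpha> (Suc (Suc n))" for n
    using bounds[of "Suc n"] by (simp add: ncf_D_Suc ncf_coeff_def field_simps)
qed (fact assms(4))

lemma davenport_iff_tail_less:
  assumes "digit_expansion (ncf_D \<alpha>) (ncf_coeff \<alpha>) b"
    and beta: "\<beta> = digit_expansion.tail (ncf_D \<alpha>) b (Suc 0)"
  shows "(0 \<le> \<beta> \<and> \<beta> < 1 \<and> (\<forall>i\<ge>1. int (b i) = davenport_coeff \<alpha> \<beta> i)) \<longleftrightarrow>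
    (\<forall>i. digit_expansion.tail (ncf_D \<alpha>) b (Suc i) < ncf_D \<alpha> i)"
proof -
  interpret digit_expansion "ncf_D \<alpha>" "ncf_coeff \<alpha>" b by fact
  have quot: "tail (Suc i) / ncf_D \<alpha> i / ncf_rem \<alpha> (Suc i)
      = real (b (Suc i)) + tail (Suc (Suc i)) / ncf_D \<alpha> (Suc i)" for i
    using D_pos[of "Suc i"] tail_Suc[of "Suc i"]
    by (simp flip: ncf_D_Suc add: field_simps)
  \<comment> \<open>Agreement is assumed only below \<open>i\<close>, so that the fact also serves
    inside the strong induction on digits.\<close>
  have rem: "davenport_rem \<alpha> \<beta> (Suc i) = tail (Suc i) / ncf_D \<alpha> i"
    if "\<And>k. k < i \<Longrightarrow> int (b (Suc k)) = davenport_coeff \<alpha> \<beta> (Suc k)" for i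
    using that
  proof (induction i)
    case 0
    show ?case by (simp add: beta ncf_D_0)
  next
    case (Suc i)
    have "davenport_rem \<alpha> \<beta> (Suc (Suc i)) =
        davenport_rem \<alpha> \<beta> (Suc i) / ncf_rem \<alpha> (Suc i) - of_int (davenport_coeff \<alpha> \<beta> (Suc i))"
      by (simp add: davenport_coeff_def)
    also have "davenport_rem \<alpha> \<beta> (Suc i) = tail (Suc i) / ncf_D \<alpha> i"
      using Suc by simp
    also have "davenport_coeff \<alpha> \<beta> (Suc i) = int (b (Suc i))"
      using Suc.prems by simp
    finally show ?case
      unfolding quot by simp
  qed
  show ?thesis
  proof
    assume L: "0 \<le> \<beta> \<and> \<beta> < 1 \<and> (\<forall>i\<ge>1. int (b i) = davenport_coeff \<alpha> \<beta> i)"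
    have rem': "davenport_rem \<alpha> \<beta> (Suc i) = tail (Suc i) / ncf_D \<alpha> i" for i
      using L by (intro rem) simp
    \<comment> \<open>Every remainder after the first is a fractional part; the first is
      \<open>\<beta>\<close> itself.\<close>
    have "davenport_rem \<alpha> \<beta> (Suc i) < 1" for i
      using L by (cases i) (simp_all, linarith)
    then show "\<forall>i. tail (Suc i) < ncf_D \<alpha> i"
      using D_pos by (simp add: rem' divide_less_eq)
  next
    assume R: "\<forall>i. tail (Suc i) < ncf_D \<alpha> i"
    \<comment> \<open>The tail bound says that the second summand of \<open>quot\<close> lies in
      [0,1), so the floor returns the digit.\<close>
    have floor: "\<lfloor>tail (Suc i) / ncf_D \<alpha> i / ncf_rem \<alpha> (Suc i)\<rfloor> = int (b (Suc i))" for i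
      unfolding quot using R tail_nonneg D_pos[of "Suc i"]
      by (intro floor_unique) (simp_all add: divide_less_eq)
    have "int (b (Suc i)) = davenport_coeff \<alpha> \<beta> (Suc i)" for i
    proof (induction i rule: less_induct)
      case (less i)
      show ?case
        unfolding davenport_coeff_def using rem[OF less] floor by presburger
    qed
    then have "int (b i) = davenport_coeff \<alpha> \<beta> i" if "i \<ge> 1" for i
      using that by (cases i) auto
    moreover have "\<beta> < 1"
      using R[rule_format, of 0] by (simp add: beta ncf_D_0)
    ultimately show "0 \<le> \<beta> \<and> \<beta> < 1 \<and> (\<forall>i\<ge>1. int (b i) = davenport_coeff \<alpha> \<beta> i)"
      using tail_nonneg beta by simp
  qed
qed

theorem theorem3p1:
  fixes \<alpha> \<beta> :: real and b :: "nat \<Rightarrow> nat"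
  assumes "0 < \<alpha>" and "\<alpha> < 1" and "\<alpha> \<notin> \<rat>"
    and "(\<lambda>k. real (b (Suc k)) * ncf_D \<alpha> (Suc k)) sums \<beta>"
  shows "(0 \<le> \<beta> \<and> \<beta> < 1 \<and> (\<forall>i\<ge>1. int (b i) = davenport_coeff \<alpha> \<beta> i)) \<longleftrightarrow>
    ((\<forall>i\<ge>1. int (b i) < ncf_coeff \<alpha> i) \<and>
     \<not> (\<exists>i j. 1 \<le> i \<and> i < j \<and>
          int (b i) = ncf_coeff \<alpha> i - 1 \<and>
          (\<forall>k. i < k \<and> k < j \<longrightarrow> int (b k) = ncf_coeff \<alpha> k - 2) \<and>
          int (b j) = ncf_coeff \<alpha> j - 1) \<and>
     \<not> (\<exists>i\<ge>1. int (b i) = ncf_coeff \<alpha> i - 1 \<and>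
          (\<forall>k>i. int (b k) = ncf_coeff \<alpha> k - 2)))"
proof -
  \<comment> \<open>The locale also counts index 0; that single term does not affect
    convergence.\<close>
  have "summable (\<lambda>k. real (b k) * ncf_D \<alpha> k)"
    using sums_summable[OF assms(4)] by (subst (asm) summable_Suc_iff)
  then interpret digit_expansion "ncf_D \<alpha>" "ncf_coeff \<alpha>" b
    using digit_expansion_ncf assms(1-3) by blast
  have "\<beta> = tail (Suc 0)"
    using sums_unique[OF assms(4)] by (simp add: tail_def)
  from davenport_iff_tail_less[OF digit_expansion_axioms this] show ?thesis
    unfolding tail_less_iff forbidden_block_def forbidden_tail_def .
qed

end
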